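(* Let $\alpha\in[1,2)$. For each $S\alpha S$ random vector $\xi$ in $\mathbb{R}^d$ with associated zonoid $K$ there exists a sub-Gaussian $S\alpha S$ random vector $\eta$ in $\mathbb{R}^d$ such that $$\mathfrak{m}_\alpha(\xi,\eta)\le(d^{\alpha/2}-1)\,\|K\|^\alpha .$$
   Context: A random vector $\xi\in\mathbb{R}^d$ is symmetric $\alpha$-stable ($S\alpha S$) if $\xi$ has the same distribution as $-\xi$ and $a^{1/\alpha}\xi_1+b^{1/\alpha}\xi_2$ has the same distribution as $(a+b)^{1/\alpha}\xi$ for all $a,b>0$, where $\xi_1,\xi_2$ are independent copies of $\xi$. Its characteristic function is $\mathbf{E}e^{i\langle\xi,u\rangle}=\exp\{-\int_{\mathbb{S}^{d-1}}|\langle u,z\rangle|^\alpha\sigma(dz)\}$ for a symmetric finite measure $\sigma$ on the Euclidean unit sphere. If $\alpha\in[1,2]$, the associated zonoid of $\xi$ is the origin-symmetric convex compact set $K$ whose support function $h(K,u)=\sup\{\langle x,u\rangle:x\in K\}$ satisfies $h(K,u)^\alpha=\int_{\mathbb{S}^{d-1}}|\langle u,z\rangle|^\alpha\sigma(dz)$, so that $\mathbf{E}e^{i\langle\xi,u\rangle}=e^{-h(K,u)^\alpha}$. $\|K\|=\sup\{\|x\|:x\in K\}$, where $\|\cdot\|$ is the Euclidean norm. An $S\alpha S$ vector $\eta$ is sub-Gaussian if $\mathbf{E}e^{i\langle\eta,u\rangle}=\exp\{-\langle Cu,u\rangle^{\alpha/2}\}$ for a symmetric positive semidefinite matrix $C$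 (equivalently, its associated zonoid is a centred, possibly lower-dimensional, ellipsoid). For two $S\alpha S$ vectors with the same $\alpha$, $$\mathfrak{m}_\alpha(\xi',\xi'')=\sup\big\{\|u\|^{-\alpha}\,\big|\log\mathbf{E}e^{i\langle u,\xi'\rangle}-\log\mathbf{E}e^{i\langle u,\xi''\rangle}\big|:\ u\in\mathbb{R}^d\setminus\{0\}\big\}.$$ *)

theory Defs
  imports "HOL-Probability.Probability"
begin

definition char_fun :: "'s measure \<Rightarrow> ('s \<Rightarrow> 'a::euclidean_space) \<Rightarrow> 'a \<Rightarrow> complex"
  where "char_fun M \<xi> u = (CLINT s|M. iexp (\<xi> s \<bullet> u))"

(* The coordinate projections of the product space M x M carry two independent copies of \<xi>. *)
definition sas :: "real \<Rightarrow> 's measure \<Rightarrow> ('s \<Rightarrow> 'a::euclidean_space) \<Rightarrow> bool"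
  where "sas \<alpha> M \<xi> \<longleftrightarrow>
    prob_space M \<and> \<xi> \<in> borel_measurable M \<and>
    distr M borel \<xi> = distr M borel (\<lambda>s. - \<xi> s) \<and>
    (\<forall>a>0. \<forall>b>0.
      distr (M \<Otimes>\<^sub>M M) borel
        (\<lambda>(s, t). a powr (1 / \<alpha>) *\<^sub>R \<xi> s + b powr (1 / \<alpha>) *\<^sub>R \<xi> t) =
      distr M borel (\<lambda>s. (a + b) powr (1 / \<alpha>) *\<^sub>R \<xi> s))"

definition spectral_measure ::
    "real \<Rightarrow> 's measure \<Rightarrow> ('s \<Rightarrow> 'a::euclidean_space) \<Rightarrow> 'a measure \<Rightarrow> bool"
  where "spectral_measure \<alpha> M \<xi> \<sigma> \<longleftrightarrow>
    sets \<sigma> = sets (restrict_space borel (sphere 0 1)) \<and> finite_measure \<sigma> \<and>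
    distr \<sigma> \<sigma> uminus = \<sigma> \<and>
    (\<forall>u. char_fun M \<xi> u =
      complex_of_real (exp (- (LINT z|\<sigma>. \<bar>u \<bullet> z\<bar> powr \<alpha>))))"

definition support_fun :: "'a::euclidean_space set \<Rightarrow> 'a \<Rightarrow> real"
  where "support_fun K u = (SUP x\<in>K. x \<bullet> u)"

(* Nonemptiness is explicit: the library's notions of compact and convex admit the empty set,
   whose real-valued supremum carries no meaning. *)
definition associated_zonoid ::
    "real \<Rightarrow> 's measure \<Rightarrow> ('s \<Rightarrow> 'a::euclidean_space) \<Rightarrow> 'a set \<Rightarrow> bool"
  where "associated_zonoid \<alpha> M \<xi> K \<longleftrightarrow>
    K \<noteq> {} \<and> compact K \<and> convex K \<and> uminus ` K = K \<and>
    (\<exists>\<sigma>. spectral_measure \<alpha> M \<xi> \<sigma> \<and>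
      (\<forall>u. support_fun K u powr \<alpha> = (LINT z|\<sigma>. \<bar>u \<bullet> z\<bar> powr \<alpha>)))"

definition set_norm :: "'a::euclidean_space set \<Rightarrow> real"
  where "set_norm K = (SUP x\<in>K. norm x)"

definition sub_gaussian :: "real \<Rightarrow> 's measure \<Rightarrow> ('s \<Rightarrow> real ^ 'n) \<Rightarrow> bool"
  where "sub_gaussian \<alpha> M \<eta> \<longleftrightarrow>
    sas \<alpha> M \<eta> \<and>
    (\<exists>C :: real ^ 'n ^ 'n. transpose C = C \<and> (\<forall>u. 0 \<le> (C *v u) \<bullet> u) \<and>
      (\<forall>u. char_fun M \<eta> u =
        complex_of_real (exp (- (((C *v u) \<bullet> u) powr (\<alpha> / 2))))))"

(* The supremum is taken in ereal, so that it is \<infinity> when the quotients are unbounded.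
   ln is the principal complex logarithm; characteristic functions of symmetric stable
   vectors are real and positive, where it is the real logarithm. *)
definition m_dist ::
    "real \<Rightarrow> 's measure \<Rightarrow> ('s \<Rightarrow> 'a::euclidean_space) \<Rightarrow> 't measure \<Rightarrow> ('t \<Rightarrow> 'a) \<Rightarrow> ereal"
  where "m_dist \<alpha> M \<xi> N \<eta> =
    (SUP u\<in>- {0}. ereal (norm u powr (- \<alpha>) *
       cmod (ln (char_fun M \<xi> u) - ln (char_fun N \<eta> u))))"

end

theory Submission imports Defs "HOL-Real_Asymp.Real_Asymp" begin

text \<open>
  Write \<open>h\<close> for the support function of \<open>K\<close> and \<open>d\<close> for the dimension. John's theorem for symmetric
  convex bodies gives an ellipsoid \<open>E\<close>, the image of the unit ball under some matrix \<open>B\<close>, with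
  \<open>E \<subseteq> K \<subseteq> sqrt d *\<^sub>R E\<close>. The support function of \<open>E\<close> at \<open>u\<close> is \<open>e u = norm (transpose B *v u)\<close>, so that
  \<open>e u \<le> h u \<le> sqrt d * e u\<close> for all \<open>u\<close> (\<open>john_symmetric_ellipsoid\<close>). The sub-Gaussian vector whose
  associated zonoid is \<open>E\<close> then does the job, because the logarithms of the two characteristic functions
  differ by
  \<open>h u powr \<alpha> - e u powr \<alpha> \<le> (d powr (\<alpha> / 2) - 1) * e u powr \<alpha> \<le> (d powr (\<alpha> / 2) - 1) * h u powr \<alpha>\<close>,
  and \<open>h u\<close> is at most \<open>set_norm K * norm u\<close>.

  The ellipsoid maximises the volume among the ellipsoids in \<open>K\<close>. If \<open>K\<close> had a point outside
  \<open>sqrt d *\<^sub>R E\<close>, stretching \<open>E\<close> slightly towards that point while shrinking it in the orthogonal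
  directions would increase the volume within \<open>K\<close>. When \<open>K\<close> has no interior, \<open>K\<close> is thickened and
  the matrices are passed to the limit.

  It remains to exhibit a random vector with characteristic function \<open>exp (- (e u powr \<alpha>))\<close>
  (\<open>sub_gaussian_exists\<close>). It is a Gaussian vector multiplied by the square root of an independent
  positive \<open>(\<alpha> / 2)\<close>-stable variable. The latter is the weak limit of normalised sums of independent
  Sibuya variables, which have the explicit generating function \<open>1 - (1 - z) powr \<beta>\<close>
  (\<open>positive_stable_exists\<close>). That the vector is \<open>S\<alpha>S\<close> is read off its characteristic function, which
  requires that characteristic functions determine distributions in several dimensions
  (\<open>char_fun_unique\<close>); this follows from the one-dimensional case, one coordinate at a time.
\<close>

section \<open>John's ellipsoid of a symmetric convex body\<close>

lemma continuous_on_det: "continuous_on S (det :: real^'n^'n \<Rightarrow> real)"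
  unfolding det_def by (intro continuous_intros)

lemma inner_matrix_adjoint:
  fixes B :: "real^'n^'m"
  shows "(B *v y) \<bullet> u = y \<bullet> (transpose B *v u)"
  by (metis dot_lmul_matrix inner_commute transpose_matrix_vector)

lemma norm_matrix_le_sum_rows:
  fixes B :: "real^'n^'m"
  shows "norm B \<le> (\<Sum>i\<in>UNIV. norm (transpose B *v axis i 1))"
proof -
  have "transpose B *v axis i 1 = B $ i" for i
    by (simp add: matrix_vector_mult_basis column_def transpose_def)
  then show ?thesis unfolding norm_vec_def[of B] by (simp only: L2_set_le_sum norm_ge_zero)
qed

text \<open>In terms of squared volume, the left factor of the product is the loss from shrinking
  \<open>d - 1\<close> axes and the right one the gain from stretching the remaining axis. The derivative of the product at
  \<open>t = 0\<close> is \<open>s - d > 0\<close>, so any small \<open>t\<close> will do; Bernoulli's inequality makes "small" explicit.\<close>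

lemma john_improvement_volume:
  fixes s :: real and d :: nat
  assumes "real d < s" "1 \<le> d"
  shows "\<exists>t. 0 < t \<and> t < 1 \<and> 1 < (1 - t) ^ (d - 1) * (1 - t + t * s)"
proof -
  \<comment> \<open>Bernoulli's inequality bounds the product from below by
    \<open>1 + t * ((s - d) - (d - 1) * t * (s - 1))\<close>; this choice makes \<open>t * (s - 1)\<close> equal to
    \<open>(s - d) / (2 * d)\<close>, so the bracket stays positive.\<close>
  define t where "t = (s - d) / (2 * d * (s - 1))"
  have s1: "s > 1" using assms by linarith
  have t0: "t > 0" unfolding t_def using assms s1 by simp
  have "s - d \<le> 1 * (s - 1)" "s - d < 2 * d * (s - 1)"
  proof -
    show "s - d \<le> 1 * (s - 1)" using assms by simp
    have "1 * (s - 1) < 2 * d * (s - 1)" using assms s1 by (intro mult_strict_right_mono) auto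
    thus "s - d < 2 * d * (s - 1)" using \<open>s - d \<le> 1 * (s - 1)\<close> by linarith
  qed
  then have t1: "t < 1" unfolding t_def using assms s1 by (simp add: field_simps)
  have td: "t * (s - 1) * (2 * d) = s - d" unfolding t_def using assms s1 by (simp add: field_simps)
  have "1 - real (d - 1) * t \<le> (1 - t) ^ (d - 1)"
    using Bernoulli_inequality[of "-t" "d - 1"] t1 by simp
  then have le: "(1 - real (d - 1) * t) * (1 - t + t * s) \<le> (1 - t) ^ (d - 1) * (1 - t + t * s)"
    by (rule mult_right_mono) (use t0 t1 s1 in simp)
  have "real (d - 1) = real d - 1" using assms by simp
  then have "(1 - real (d - 1) * t) * (1 - t + t * s) = 1 + t * ((s - d) - (real d - 1) * (t * (s - 1)))"
    by (simp add: algebra_simps)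
  moreover have "(real d - 1) * (t * (s - 1)) < s - d"
  proof -
    have "(real d - 1) * (t * (s - 1)) < (2 * d) * (t * (s - 1))"
      by (rule mult_strict_right_mono) (use t0 s1 assms in auto)
    then show ?thesis using td by (simp add: mult.commute)
  qed
  ultimately have "1 < (1 - real (d - 1) * t) * (1 - t + t * s)" using t0 by simp
  with le have "1 < (1 - t) ^ (d - 1) * (1 - t + t * s)" by linarith
  with t0 t1 show ?thesis by blast
qed

text \<open>This is the ellipsoid with one distinguished half-axis: the first claim computes its squared
  support function and the second its squared volume relative to the unit ball.\<close>

lemma norm_diag_stretch:
  fixes w :: "real^'n" and p q :: real and k :: 'n
  assumes "0 \<le> p" "0 \<le> q"
  defines "D \<equiv> (\<chi> i j. if i = j then sqrt (if i = k then q else p) else 0) :: real^'n^'n"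
  shows "(norm (transpose D *v w))\<^sup>2 = p * (norm w)\<^sup>2 + (q - p) * (w $ k)\<^sup>2"
    and "(det D)\<^sup>2 = p ^ (CARD('n) - 1) * q"
proof -
  have D: "(transpose D *v w) $ i = sqrt (if i = k then q else p) * w $ i" for i
  proof -
    have "(transpose D *v w) $ i = (\<Sum>j\<in>UNIV. if j = i then sqrt (if i = k then q else p) * w $ i else 0)"
      unfolding D_def transpose_def matrix_vector_mult_def vec_lambda_beta by (intro sum.cong) auto
    then show ?thesis by simp
  qed
  have "(norm (transpose D *v w))\<^sup>2 = (\<Sum>i\<in>UNIV. (if i = k then q else p) * (w $ i)\<^sup>2)"
    unfolding dot_square_norm[symmetric] inner_vec_def D inner_real_def
  proof (rule sum.cong[OF refl])
    fix i
    have "sqrt c * x * (sqrt c * x) = c * x\<^sup>2" if "0 \<le> c" for c x :: real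
    proof -
      have "sqrt c * x * (sqrt c * x) = (sqrt c * sqrt c) * (x * x)" by (simp only: ac_simps)
      then show ?thesis using that by (simp add: power2_eq_square)
    qed
    then show "sqrt (if i = k then q else p) * w $ i * (sqrt (if i = k then q else p) * w $ i) = (if i = k then q else p) * (w $ i)\<^sup>2"
      using assms by simp
  qed
  also have "\<dots> = (\<Sum>i\<in>UNIV. p * (w $ i)\<^sup>2 + (if i = k then (q - p) * (w $ k)\<^sup>2 else 0))"
    by (auto intro!: sum.cong simp: algebra_simps)
  also have "\<dots> = p * (norm w)\<^sup>2 + (q - p) * (w $ k)\<^sup>2"
    unfolding dot_square_norm[symmetric] inner_vec_def
    by (simp add: sum.distrib sum_distrib_left power2_eq_square)
  finally show "(norm (transpose D *v w))\<^sup>2 = p * (norm w)\<^sup>2 + (q - p) * (w $ k)\<^sup>2" .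
  have "det D = (\<Prod>i\<in>UNIV. D $ i $ i)"
    by (rule det_diagonal) (simp add: D_def)
  then have "(det D)\<^sup>2 = (\<Prod>i\<in>UNIV. if i = k then q else p)"
    using assms(1,2) by (auto simp: D_def prod_power_distrib intro!: prod.cong)
  also have "\<dots> = q * (\<Prod>i\<in>UNIV - {k}. p)"
    by (subst prod.remove[of _ k]) (auto intro!: prod.cong)
  finally show "(det D)\<^sup>2 = p ^ (CARD('n) - 1) * q" by (simp add: card_Diff_singleton)
qed

text \<open>This is the step of John's argument that enlarges a non-maximal ellipsoid. If \<open>y\<close> is longer than
  \<open>sqrt d\<close>, then the convex hull of the unit ball and \<open>\<plusminus> y\<close> contains an ellipsoid with axis along \<open>y\<close>
  of volume larger than the ball. Its squared support function is a convex combination of the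
  squared support functions of the ball and of the segment from \<open>-y\<close> to \<open>y\<close>, which is why it lies
  in the hull. Here everything is transported by \<open>B\<close>, and \<open>y\<close> is first rotated to a coordinate axis
  so that the determinant is that of a diagonal matrix.\<close>

lemma linear_image_stretch:
  fixes B :: "real^'n^'n" and y :: "real^'n"
  assumes "det B \<noteq> 0" and "real CARD('n) < (norm y)\<^sup>2"
  shows "\<exists>B' t. 0 < t \<and> t < 1 \<and> \<bar>det B\<bar> < \<bar>det B'\<bar> \<and>
    (\<forall>u. (norm (transpose B' *v u))\<^sup>2 = (1 - t) * (norm (transpose B *v u))\<^sup>2 + t * ((B *v y) \<bullet> u)\<^sup>2)"
proof -
  obtain t where t: "0 < t" "t < 1" "1 < (1 - t) ^ (CARD('n) - 1) * (1 - t + t * (norm y)\<^sup>2)"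
    using john_improvement_volume[OF assms(2)] by (auto simp: Suc_le_eq)
  have y0: "norm y > 0" using assms(2) by (cases "y = 0") auto
  define k :: 'n where "k = undefined"
  define e where "e = y /\<^sub>R norm y"
  have "norm e = 1" using y0 by (simp add: e_def)
  then obtain Q :: "real^'n^'n" where Q: "orthogonal_matrix Q" "Q *v axis k 1 = e"
    using orthogonal_matrix_exists_basis by metis
  define p q where "p = 1 - t" and "q = 1 - t + t * (norm y)\<^sup>2"
  have pq: "0 \<le> p" "0 \<le> q" using t by (auto simp: p_def q_def)
  define D :: "real^'n^'n" where "D = (\<chi> i j. if i = j then sqrt (if i = k then q else p) else 0)"
  note D = norm_diag_stretch[OF pq, of k, folded D_def]
  have "(det Q)\<^sup>2 = 1" using det_orthogonal_matrix[OF Q(1)] by auto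
  then have "(det (B ** Q ** D))\<^sup>2 = (det B)\<^sup>2 * (p ^ (CARD('n) - 1) * q)"
    using D(2) by (simp add: det_mul power_mult_distrib)
  also have "\<dots> > (det B)\<^sup>2 * 1" using t assms(1) unfolding p_def q_def
    by (intro mult_strict_left_mono) auto
  finally have det: "\<bar>det B\<bar> < \<bar>det (B ** Q ** D)\<bar>" by (simp add: abs_less_iff power2_less_imp_less flip: abs_le_square_iff linorder_not_le)
  have "(norm (transpose (B ** Q ** D) *v u))\<^sup>2 = (1 - t) * (norm (transpose B *v u))\<^sup>2 + t * ((B *v y) \<bullet> u)\<^sup>2" for u
  proof -
    define v where "v = transpose B *v u"
    define w where "w = transpose Q *v v"
    have "norm w = norm v" unfolding w_def
      using Q(1) orthogonal_transformation_matrix[of "(*v) (transpose Q)"]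
      by (simp add: orthogonal_matrix_transpose orthogonal_transformation)
    have "w $ k = w \<bullet> axis k 1" by (simp add: cart_eq_inner_axis)
    also have "\<dots> = v \<bullet> e" unfolding w_def Q(2)[symmetric]
      by (metis inner_matrix_adjoint transpose_transpose)
    finally have "w $ k = v \<bullet> e" .
    moreover have "v \<bullet> y = (B *v y) \<bullet> u" unfolding v_def
      by (metis inner_matrix_adjoint inner_commute)
    ultimately have "w $ k * norm y = (B *v y) \<bullet> u" using y0 by (simp add: e_def)
    then have "((B *v y) \<bullet> u)\<^sup>2 = (w $ k)\<^sup>2 * (norm y)\<^sup>2" by (metis power_mult_distrib)
    then have wk: "(q - p) * (w $ k)\<^sup>2 = t * ((B *v y) \<bullet> u)\<^sup>2" by (simp add: q_def p_def)
    have "transpose (B ** Q ** D) *v u = transpose D *v w"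
      unfolding w_def v_def matrix_transpose_mul matrix_vector_mul_assoc ..
    then show ?thesis using D(1)[of w] wk \<open>norm w = norm v\<close> unfolding v_def[symmetric] p_def
      by metis
  qed
  with t det show ?thesis by blast
qed

text \<open>The first hypothesis says that \<open>h\<close> is the support function of a symmetric set and is attained at
  each \<open>u\<close>; the second that this set contains a ball. Among the matrices \<open>B\<close> that map the unit ball
  into the set, one with maximal \<open>\<bar>det B\<bar>\<close> exists by compactness, and it is invertible because a small
  multiple of the identity competes. If a support point \<open>B *v y\<close> had \<open>norm y > sqrt d\<close>, the
  previous lemma would produce a competitor of larger determinant.\<close>

lemma john_nondegenerate:
  fixes h :: "real^'n \<Rightarrow> real"
  assumes supp: "\<And>u. \<exists>x. x \<bullet> u = h u \<and> (\<forall>v. \<bar>x \<bullet> v\<bar> \<le> h v)"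
    and c: "0 < c" "\<And>u. c * norm u \<le> h u"
  shows "\<exists>B :: real^'n^'n. \<forall>u. norm (transpose B *v u) \<le> h u \<and>
           h u \<le> sqrt CARD('n) * norm (transpose B *v u)"
proof -
  define F where "F = {B :: real^'n^'n. \<forall>u. norm (transpose B *v u) \<le> h u}"
  have h0: "0 \<le> h u" for u using c by (meson less_eq_real_def mult_nonneg_nonneg norm_ge_zero order_trans)
  have "closed F"
  proof -
    have "F = (\<Inter>u. {B. norm (transpose B *v u) \<le> h u})" by (auto simp: F_def)
    moreover have "closed {B :: real^'n^'n. norm (transpose B *v u) \<le> h u}" for u
      unfolding transpose_def matrix_vector_mult_def
      by (intro closed_Collect_le continuous_intros)
    ultimately show ?thesis by auto
  qed
  moreover have "bounded F"
  proof -
    define R where "R = (\<Sum>i\<in>UNIV. h (axis i 1 :: real^'n))"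
    have "norm B \<le> R" if "B \<in> F" for B
      using that unfolding R_def F_def by (intro order_trans[OF norm_matrix_le_sum_rows] sum_mono) blast
    then show ?thesis by (auto simp: bounded_iff)
  qed
  ultimately have "compact F" by (simp add: compact_eq_bounded_closed)
  moreover have cF: "c *\<^sub>R mat 1 \<in> F"
  proof -
    have "transpose (c *\<^sub>R mat 1 :: real^'n^'n) = c *\<^sub>R mat 1"
      by (auto simp: transpose_def mat_def vec_eq_iff)
    then show ?thesis unfolding F_def mem_Collect_eq
      using c by (simp only: scaleR_matrix_vector_assoc[symmetric] matrix_vector_mul_lid norm_scaleR) simp
  qed
  ultimately obtain B where B: "B \<in> F" "\<And>B'. B' \<in> F \<Longrightarrow> \<bar>det B'\<bar> \<le> \<bar>det B\<bar>"
    using continuous_attains_sup[of F "\<lambda>B. \<bar>det B\<bar>"] continuous_on_rabs[OF continuous_on_det] by blast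
  have "det (c *\<^sub>R mat 1 :: real^'n^'n) \<noteq> 0"
    using c by (subst det_diagonal) (auto simp: mat_def)
  then have dB: "det B \<noteq> 0" using B(2)[OF cF] by auto
  have BF: "norm (transpose B *v u) \<le> h u" for u using B(1) by (simp add: F_def)
  have "h u \<le> sqrt CARD('n) * norm (transpose B *v u)" for u
  proof -
    obtain x where x: "x \<bullet> u = h u" "\<And>v. \<bar>x \<bullet> v\<bar> \<le> h v" using supp by blast
    have "invertible B" using dB invertible_det_nz by blast
    then obtain y where y: "x = B *v y"
      by (metis invertible_def matrix_vector_mul_assoc matrix_vector_mul_lid)
    have "(norm y)\<^sup>2 \<le> CARD('n)"
    proof (rule ccontr)
      assume "\<not> ?thesis"
      then obtain B' t where t: "0 < t" "t < 1" and d: "\<bar>det B\<bar> < \<bar>det B'\<bar>"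
        and n: "\<And>v. (norm (transpose B' *v v))\<^sup>2 = (1 - t) * (norm (transpose B *v v))\<^sup>2 + t * (x \<bullet> v)\<^sup>2"
        using linear_image_stretch[OF dB, of y] y by auto
      have "B' \<in> F" unfolding F_def
      proof safe
        fix v
        have "(norm (transpose B *v v))\<^sup>2 \<le> (h v)\<^sup>2" by (rule power_mono[OF BF norm_ge_zero])
        moreover have "(x \<bullet> v)\<^sup>2 \<le> (h v)\<^sup>2" using x(2)[of v] by (rule abs_le_square_iff[THEN iffD1, OF order_trans]) simp
        ultimately have "(norm (transpose B' *v v))\<^sup>2 \<le> (1 - t) * (h v)\<^sup>2 + t * (h v)\<^sup>2" unfolding n
          using t by (intro add_mono mult_left_mono) auto
        also have "\<dots> = (h v)\<^sup>2" by (simp add: algebra_simps)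
        finally show "norm (transpose B' *v v) \<le> h v" using h0[of v] by (rule power2_le_imp_le)
      qed
      from B(2)[OF this] d show False by linarith
    qed
    then have ny: "norm y \<le> sqrt CARD('n)" by (simp add: real_le_rsqrt)
    have "h u = y \<bullet> (transpose B *v u)" unfolding x(1)[symmetric] y
      by (rule inner_matrix_adjoint)
    also have "\<dots> \<le> norm y * norm (transpose B *v u)" by (rule norm_cauchy_schwarz)
    also have "\<dots> \<le> sqrt CARD('n) * norm (transpose B *v u)" using ny by (rule mult_right_mono) simp
    finally show ?thesis .
  qed
  with BF show ?thesis by blast
qed

text \<open>A set with empty interior is thickened to \<open>h u + \<epsilon> * norm u\<close>, and the matrices found for the
  thickened sets are bounded, so a subsequence converges as \<open>\<epsilon>\<close> tends to \<open>0\<close>. Both inequalities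
  are closed conditions and pass to the limit; only invertibility of the matrix is lost.\<close>

lemma john_symmetric_ellipsoid:
  fixes h :: "real^'n \<Rightarrow> real"
  assumes supp: "\<And>u. \<exists>x. x \<bullet> u = h u \<and> (\<forall>v. \<bar>x \<bullet> v\<bar> \<le> h v)"
  shows "\<exists>B :: real^'n^'n. \<forall>u. norm (transpose B *v u) \<le> h u \<and>
           h u \<le> sqrt CARD('n) * norm (transpose B *v u)"
proof -
  have h0: "0 \<le> h u" for u using supp by (meson abs_ge_zero order_trans)
  define \<epsilon> where "\<epsilon> m = 1 / real (Suc m)" for m
  have \<epsilon>: "0 < \<epsilon> m" "\<epsilon> m \<le> 1" for m by (auto simp: \<epsilon>_def)
  have "\<exists>B :: real^'n^'n. \<forall>u. norm (transpose B *v u) \<le> h u + \<epsilon> m * norm u \<and>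
           h u + \<epsilon> m * norm u \<le> sqrt CARD('n) * norm (transpose B *v u)" for m
  proof (rule john_nondegenerate[OF _ \<epsilon>(1)[of m]])
    fix u :: "real^'n"
    show "\<epsilon> m * norm u \<le> h u + \<epsilon> m * norm u" using h0 by simp
    obtain x where x: "x \<bullet> u = h u" "\<And>v. \<bar>x \<bullet> v\<bar> \<le> h v" using supp by blast
    \<comment> \<open>The thickened set is the Minkowski sum with a ball of radius \<open>\<epsilon> m\<close>, so its support point
      in direction \<open>u\<close> is moved by \<open>\<epsilon> m\<close> along \<open>u\<close>.\<close>
    let ?x = "x + \<epsilon> m *\<^sub>R sgn u"
    have "?x \<bullet> u = h u + \<epsilon> m * norm u"
      using x(1) by (cases "u = 0") (simp_all add: inner_add_left sgn_div_norm dot_square_norm power2_eq_square)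
    moreover have "\<bar>?x \<bullet> v\<bar> \<le> h v + \<epsilon> m * norm v" for v
    proof -
      have "\<bar>sgn u \<bullet> v\<bar> \<le> norm (sgn u) * norm v" by (rule Cauchy_Schwarz_ineq2)
      also have "\<dots> \<le> 1 * norm v" by (rule mult_right_mono) (auto simp: norm_sgn)
      finally have "\<bar>\<epsilon> m * (sgn u \<bullet> v)\<bar> \<le> \<epsilon> m * norm v" using \<epsilon>(1)[of m] by (simp add: abs_mult)
      with x(2)[of v] show ?thesis by (simp add: inner_add_left)
    qed
    ultimately show "\<exists>x. x \<bullet> u = h u + \<epsilon> m * norm u \<and> (\<forall>v. \<bar>x \<bullet> v\<bar> \<le> h v + \<epsilon> m * norm v)" by blast
  qed
  then obtain B :: "nat \<Rightarrow> real^'n^'n" where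
    B1: "\<And>m u. norm (transpose (B m) *v u) \<le> h u + \<epsilon> m * norm u" and
    B2: "\<And>m u. h u + \<epsilon> m * norm u \<le> sqrt CARD('n) * norm (transpose (B m) *v u)"
    by metis
  have "bounded (range B)"
  proof -
    define R where "R = (\<Sum>i\<in>UNIV. h (axis i 1 :: real^'n) + 1)"
    have "norm (B m) \<le> R" for m
      unfolding R_def
    proof (intro order_trans[OF norm_matrix_le_sum_rows] sum_mono)
      show "norm (transpose (B m) *v axis i 1) \<le> h (axis i 1) + 1" for i
        using B1[of m "axis i 1"] \<epsilon>(2)[of m] by simp
    qed
    then show ?thesis by (auto simp: bounded_iff)
  qed
  then obtain L r where r: "strict_mono r" and L: "(B \<circ> r) \<longlonglongrightarrow> L"
    using bounded_imp_convergent_subsequence by blast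
  have lim: "(\<lambda>m. norm (transpose (B (r m)) *v u)) \<longlonglongrightarrow> norm (transpose L *v u)" for u
  proof -
    have "continuous_on UNIV (\<lambda>A :: real^'n^'n. norm (transpose A *v u))"
      unfolding transpose_def matrix_vector_mult_def
      by (intro continuous_intros)
    then have "isCont (\<lambda>A :: real^'n^'n. norm (transpose A *v u)) L"
      by (simp add: continuous_on_eq_continuous_at)
    from isCont_tendsto_compose[OF this L] show ?thesis by (simp add: o_def)
  qed
  have "\<epsilon> \<longlonglongrightarrow> 0" unfolding \<epsilon>_def by (rule LIMSEQ_Suc) (rule lim_1_over_n)
  then have "(\<lambda>m. \<epsilon> (r m)) \<longlonglongrightarrow> 0" using r LIMSEQ_subseq_LIMSEQ[of \<epsilon> 0 r] by (simp add: o_def)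
  then have lim2: "(\<lambda>m. h u + \<epsilon> (r m) * norm u) \<longlonglongrightarrow> h u" for u
    by (auto intro!: tendsto_eq_intros)
  have "norm (transpose L *v u) \<le> h u" for u
    using B1 by (intro LIMSEQ_le[OF lim lim2]) auto
  moreover have "h u \<le> sqrt CARD('n) * norm (transpose L *v u)" for u
    using B2 by (intro LIMSEQ_le[OF lim2 tendsto_mult_left[OF lim]]) auto
  ultimately show ?thesis by blast
qed

section \<open>Uniqueness of multivariate characteristic functions\<close>

text \<open>A bounded nonnegative weight turns a probability measure into a multiple of another one, so
  uniqueness of one-dimensional characteristic functions carries over to weighted transforms. The
  transform at \<open>t = 0\<close> shows that the two normalising constants agree.\<close>

lemma weighted_fourier_uniqueness:
  fixes X :: "'a \<Rightarrow> real" and W :: "'a \<Rightarrow> real" and X' :: "'b \<Rightarrow> real" and W' :: "'b \<Rightarrow> real"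
  assumes M: "prob_space M" and M': "prob_space M'"
    and X[measurable]: "X \<in> borel_measurable M" "X' \<in> borel_measurable M'"
    and W[measurable]: "W \<in> borel_measurable M" "W' \<in> borel_measurable M'"
    and Wb: "\<And>x. 0 \<le> W x" "\<And>x. W x \<le> c" "\<And>x. 0 \<le> W' x" "\<And>x. W' x \<le> c"
    and eq: "\<And>t. (CLINT x|M. W x *\<^sub>R iexp (t * X x)) = (CLINT x|M'. W' x *\<^sub>R iexp (t * X' x))"
    and A[measurable]: "A \<in> sets borel"
  shows "(LINT x|M. W x * indicator A (X x)) = (LINT x|M'. W' x * indicator A (X' x))"
proof -
  interpret M: prob_space M by fact
  interpret M': prob_space M' by fact
  define m where "m = (LINT x|M. W x)"
  have iW: "integrable M W" "integrable M' W'"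
    using Wb by (auto intro!: M.integrable_const_bound[where B=c] M'.integrable_const_bound[where B=c])
  have "complex_of_real m = complex_of_real (LINT x|M'. W' x)"
    using eq[of 0] by (simp add: m_def scaleR_conv_of_real)
  then have m': "(LINT x|M'. W' x) = m" by simp
  show ?thesis
  proof (cases "m = 0")
    case True
    then have "AE x in M. W x = 0" "AE x in M'. W' x = 0"
      using integral_nonneg_eq_0_iff_AE[OF iW(1)] integral_nonneg_eq_0_iff_AE[OF iW(2)] Wb m' m_def by auto
    then have *: "AE x in M. W x * indicator A (X x) = (0::real)" "AE x in M'. W' x * indicator A (X' x) = (0::real)"
      by auto
    show ?thesis using integral_eq_zero_AE[OF *(1)] integral_eq_zero_AE[OF *(2)] by simp
  next
    case False
    then have m: "m > 0" using Wb by (auto simp: m_def less_le intro!: Bochner_Integration.integral_nonneg)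
    define P where "P = distr (density M (\<lambda>x. W x / m)) borel X"
    define P' where "P' = distr (density M' (\<lambda>x. W' x / m)) borel X'"
    have int_P: "(LINT y|P. f y) = (LINT x|M. (W x / m) *\<^sub>R f (X x))" if [measurable]: "f \<in> borel_measurable borel"
      for f :: "real \<Rightarrow> 'c::{banach, second_countable_topology}"
      unfolding P_def using m Wb by (subst integral_distr) (auto simp: integral_density)
    have int_P': "(LINT y|P'. f y) = (LINT x|M'. (W' x / m) *\<^sub>R f (X' x))" if [measurable]: "f \<in> borel_measurable borel"
      for f :: "real \<Rightarrow> 'c::{banach, second_countable_topology}"
      unfolding P'_def using m Wb by (subst integral_distr) (auto simp: integral_density)
    have "prob_space (density M (\<lambda>x. W x / m))"
      using m Wb iW m' by (intro prob_spaceI) (simp add: emeasure_density nn_integral_eq_integral m_def)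
    then have P: "real_distribution P"
      unfolding P_def by (intro real_distribution.intro real_distribution_axioms.intro prob_space.prob_space_distr) auto
    have "prob_space (density M' (\<lambda>x. W' x / m))"
      using m Wb iW m' by (intro prob_spaceI) (simp add: emeasure_density nn_integral_eq_integral)
    then have P': "real_distribution P'"
      unfolding P'_def by (intro real_distribution.intro real_distribution_axioms.intro prob_space.prob_space_distr) auto
    have "char P = char P'"
    proof
      fix t
      have "char P t = (CLINT x|M. (W x / m) *\<^sub>R iexp (t * X x))"
        unfolding char_def by (rule int_P) simp
      also have "\<dots> = (1/m) *\<^sub>R (CLINT x|M. W x *\<^sub>R iexp (t * X x))"
        by (simp flip: integral_scaleR_right)
      also have "\<dots> = (CLINT x|M'. (W' x / m) *\<^sub>R iexp (t * X' x))"
        unfolding eq by (simp flip: integral_scaleR_right)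
      also have "\<dots> = char P' t"
        unfolding char_def by (rule int_P'[symmetric]) simp
      finally show "char P t = char P' t" .
    qed
    then have "P = P'" using Levy_uniqueness P P' by blast
    then have "(LINT x|M. (W x / m) *\<^sub>R (indicator A (X x) :: real)) = (LINT x|M'. (W' x / m) *\<^sub>R indicator A (X' x))"
      using int_P[of "indicator A :: real \<Rightarrow> real"] int_P'[of "indicator A :: real \<Rightarrow> real"] by simp
    then show ?thesis using m by simp
  qed
qed

text \<open>Indicators of coordinates are introduced one at a time. With the indicators of \<open>S\<close> in place and
  one further coordinate \<open>j\<close>, the plane waves \<open>iexp (x \<bullet> u)\<close> with \<open>u\<close> varying along the axis \<open>j\<close>
  provide the one-dimensional transform in \<open>x $ j\<close>. Complex weights are not admissible in the previous
  lemma, hence the waves are replaced by the nonnegative functions \<open>1 + cos (x \<bullet> u + \<theta>)\<close>, from which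
  the real and imaginary parts are recovered by subtraction.\<close>

lemma char_fun_determines_box_weights:
  fixes \<mu> \<nu> :: "(real^'n) measure"
  assumes \<mu>: "prob_space \<mu>" "sets \<mu> = sets borel" and \<nu>: "prob_space \<nu>" "sets \<nu> = sets borel"
    and eq: "\<And>u. char_fun \<mu> (\<lambda>x. x) u = char_fun \<nu> (\<lambda>x. x) u"
    and A: "\<And>i. A i \<in> sets borel"
  shows "finite S \<Longrightarrow> (CLINT x|\<mu>. (\<Prod>i\<in>S. indicator (A i) (x $ i) :: real) *\<^sub>R iexp (x \<bullet> u)) =
     (CLINT x|\<nu>. (\<Prod>i\<in>S. indicator (A i) (x $ i) :: real) *\<^sub>R iexp (x \<bullet> u))"
proof (induction S arbitrary: u rule: finite_induct)
  case empty
  then show ?case using eq[of u] by (simp add: char_fun_def)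
next
  case (insert j S)
  note [measurable_cong] = \<mu>(2) \<nu>(2)
  note [measurable] = A
  interpret \<mu>: prob_space \<mu> by fact
  interpret \<nu>: prob_space \<nu> by fact
  define I :: "real^'n \<Rightarrow> real" where "I x = (\<Prod>i\<in>S. indicator (A i) (x $ i))" for x
  have [measurable]: "I \<in> borel_measurable borel" unfolding I_def by measurable
  have I01: "0 \<le> I x" "I x \<le> 1" for x unfolding I_def
    by (auto intro!: prod_nonneg prod_le_1 split: split_indicator)
  define J :: "real^'n \<Rightarrow> real" where "J x = indicator (A j) (x $ j)" for x
  have [measurable]: "J \<in> borel_measurable borel" unfolding J_def by measurable
  have J01: "0 \<le> J x" "J x \<le> 1" for x unfolding J_def by (auto split: split_indicator)
  have IH: "(CLINT x|\<mu>. I x *\<^sub>R iexp (x \<bullet> v)) = (CLINT x|\<nu>. I x *\<^sub>R iexp (x \<bullet> v))" for v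
    unfolding I_def by (rule insert.IH)
  have W0: "0 \<le> I x * (1 + cos (x \<bullet> u + \<theta>))" for x u \<theta>
      using I01[of x] cos_ge_minus_one[of "x \<bullet> u + \<theta>"] by (intro mult_nonneg_nonneg) linarith+
  have W2: "I x * (1 + cos (x \<bullet> u + \<theta>)) \<le> 2" for x u \<theta>
    proof -
      have "0 \<le> 1 + cos (x \<bullet> u + \<theta>)" "1 + cos (x \<bullet> u + \<theta>) \<le> 2"
        using cos_ge_minus_one[of "x \<bullet> u + \<theta>"] cos_le_one[of "x \<bullet> u + \<theta>"] by linarith+
      with I01[of x] mult_mono[of "I x" 1 "1 + cos (x \<bullet> u + \<theta>)" 2] show ?thesis by linarith
    qed
  have step: "(LINT x|\<mu>. (I x * (1 + cos (x \<bullet> u + \<theta>))) * J x) = (LINT x|\<nu>. (I x * (1 + cos (x \<bullet> u + \<theta>))) * J x)" for u \<theta>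
    unfolding J_def
  proof (rule weighted_fourier_uniqueness[where c = 2])
    fix t
    let ?e = "t *\<^sub>R axis j 1 :: real^'n"
    \<comment> \<open>Euler's formula splits the cosine into two waves, so the weighted transform in coordinate \<open>j\<close>
      is a combination of three integrals covered by the induction hypothesis.\<close>
    have *: "(I x * (1 + cos (x \<bullet> u + \<theta>))) *\<^sub>R iexp (t * x $ j) =
        I x *\<^sub>R iexp (x \<bullet> ?e) + (iexp \<theta> / 2) * (I x *\<^sub>R iexp (x \<bullet> (?e + u)))
          + (iexp (- \<theta>) / 2) * (I x *\<^sub>R iexp (x \<bullet> (?e - u)))" for x
    proof -
      have e: "iexp (x \<bullet> ?e) = iexp (t * x $ j)" by (simp add: inner_axis)
      have a: "iexp (x \<bullet> (?e + u)) * iexp \<theta> = iexp (t * x $ j) * iexp (x \<bullet> u + \<theta>)"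
        by (simp add: inner_axis inner_add_right algebra_simps flip: exp_add)
      have b: "iexp (x \<bullet> (?e - u)) * iexp (- \<theta>) = iexp (t * x $ j) * iexp (- (x \<bullet> u + \<theta>))"
        by (simp add: inner_axis inner_diff_right algebra_simps flip: exp_add)
      have c: "complex_of_real (cos (x \<bullet> u + \<theta>)) = (iexp (x \<bullet> u + \<theta>) + iexp (- (x \<bullet> u + \<theta>))) / 2"
        by (simp add: cos_exp_eq algebra_simps flip: cos_of_real)
      have "(I x * (1 + cos (x \<bullet> u + \<theta>))) *\<^sub>R iexp (t * x $ j) = 
        I x * (iexp (t * x $ j) + (iexp (t * x $ j) * iexp (x \<bullet> u + \<theta>)) / 2 + (iexp (t * x $ j) * iexp (- (x \<bullet> u + \<theta>))) / 2)"
        unfolding scaleR_conv_of_real of_real_mult of_real_add c by (simp add: algebra_simps)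
      also have "\<dots> = I x * (iexp (x \<bullet> ?e) + (iexp (x \<bullet> (?e + u)) * iexp \<theta>) / 2 + (iexp (x \<bullet> (?e - u)) * iexp (- \<theta>)) / 2)"
        unfolding a b e ..
      also have "\<dots> = I x *\<^sub>R iexp (x \<bullet> ?e) + (iexp \<theta> / 2) * (I x *\<^sub>R iexp (x \<bullet> (?e + u)))
          + (iexp (- \<theta>) / 2) * (I x *\<^sub>R iexp (x \<bullet> (?e - u)))"
      proof -
        have "r * (e1 + (e2 * f2) / 2 + (e3 * f3) / 2) = r * e1 + (f2 / 2) * (r * e2) + (f3 / 2) * (r * e3)"
          for r e1 e2 e3 f2 f3 :: complex by (simp add: algebra_simps)
        then show ?thesis unfolding scaleR_conv_of_real .
      qed
      finally show ?thesis .
    qed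
    have i\<mu>: "integrable \<mu> (\<lambda>x. I x *\<^sub>R iexp (x \<bullet> v))" for v
      using I01 by (intro \<mu>.integrable_const_bound[where B=1]) (auto simp: abs_le_iff intro: order_trans[of _ 0])
    have i\<nu>: "integrable \<nu> (\<lambda>x. I x *\<^sub>R iexp (x \<bullet> v))" for v
      using I01 by (intro \<nu>.integrable_const_bound[where B=1]) (auto simp: abs_le_iff intro: order_trans[of _ 0])
    show "(CLINT x|\<mu>. (I x * (1 + cos (x \<bullet> u + \<theta>))) *\<^sub>R iexp (t * x $ j)) =
        (CLINT x|\<nu>. (I x * (1 + cos (x \<bullet> u + \<theta>))) *\<^sub>R iexp (t * x $ j))"
    proof -
      have lin: "(CLINT x|\<rho>. f x + a * g x + b * h x) = (CLINT x|\<rho>. f x) + a * (CLINT x|\<rho>. g x) + b * (CLINT x|\<rho>. h x)"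
        if "integrable \<rho> f" "integrable \<rho> g" "integrable \<rho> h" for \<rho> :: "(real^'n) measure" and f g h a b
        using that by simp
      show ?thesis unfolding * lin[OF i\<mu> i\<mu> i\<mu>] lin[OF i\<nu> i\<nu> i\<nu>] IH ..
    qed
  qed (use \<mu> \<nu> W0 W2 in \<open>auto simp: A\<close>)
  \<comment> \<open>The subtracted terms have \<open>cos (pi / 2) = 0\<close>, so they are the integrals of \<open>I x * J x\<close> alone;
    the phase \<open>- pi / 2\<close> turns the cosine into a sine.\<close>
  have split: "(CLINT x|\<rho>. (I x * J x) *\<^sub>R iexp (x \<bullet> u)) =
      Complex ((LINT x|\<rho>. (I x * (1 + cos (x \<bullet> u))) * J x) - (LINT x|\<rho>. (I x * (1 + cos (x \<bullet> 0 + pi / 2))) * J x))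
        ((LINT x|\<rho>. (I x * (1 + cos (x \<bullet> u - pi / 2))) * J x) - (LINT x|\<rho>. (I x * (1 + cos (x \<bullet> 0 + pi / 2))) * J x))"
    if "prob_space \<rho>" and s[measurable_cong]: "sets \<rho> = sets borel" for \<rho> :: "(real^'n) measure"
  proof -
    interpret \<rho>: prob_space \<rho> by fact
    have IJ: "0 \<le> I x * J x" "I x * J x \<le> 1" for x
      using I01[of x] J01[of x] by (auto intro: mult_le_one)
    have bounded: "integrable \<rho> (\<lambda>x. (I x * J x) *\<^sub>R f x)"
      if [measurable]: "f \<in> borel_measurable borel" and f: "\<And>x. norm (f x) \<le> 1"
      for f :: "real^'n \<Rightarrow> 'c::{banach, second_countable_topology}"
    proof (rule \<rho>.integrable_const_bound[where B=1])
      have "norm ((I x * J x) *\<^sub>R f x) \<le> 1" for x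
        using IJ[of x] mult_mono[of "I x * J x" 1 "norm (f x)" 1] f[of x] abs_of_nonneg[OF IJ(1)[of x]]
        by (simp only: norm_scaleR) simp
      then show "AE x in \<rho>. norm ((I x * J x) *\<^sub>R f x) \<le> 1" by simp
    qed measurable
    have int: "integrable \<rho> (\<lambda>x. I x * J x)" "integrable \<rho> (\<lambda>x. I x * J x * cos (x \<bullet> u))"
       "integrable \<rho> (\<lambda>x. I x * J x * sin (x \<bullet> u))"
      using bounded[of "\<lambda>x. 1 :: real"] bounded[of "\<lambda>x. cos (x \<bullet> u)"] bounded[of "\<lambda>x. sin (x \<bullet> u)"] by simp_all
    have intc: "integrable \<rho> (\<lambda>x. (I x * J x) *\<^sub>R iexp (x \<bullet> u))"
      by (rule bounded) simp_all
    have "Re (CLINT x|\<rho>. (I x * J x) *\<^sub>R iexp (x \<bullet> u)) = (LINT x|\<rho>. I x * J x * cos (x \<bullet> u))"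
      "Im (CLINT x|\<rho>. (I x * J x) *\<^sub>R iexp (x \<bullet> u)) = (LINT x|\<rho>. I x * J x * sin (x \<bullet> u))"
      using intc by (simp_all add: Re_exp Im_exp flip: integral_Re integral_Im)
    then show ?thesis using int
      by (simp add: complex_eq_iff algebra_simps cos_diff)
  qed
  have "(CLINT x|\<mu>. (I x * J x) *\<^sub>R iexp (x \<bullet> u)) = (CLINT x|\<nu>. (I x * J x) *\<^sub>R iexp (x \<bullet> u))"
    using split[OF \<mu>] split[OF \<nu>] step[of u 0] step[of u "- pi/2"] step[of 0 "pi / 2"] by simp
  then show ?case using insert by (simp add: I_def J_def mult.commute)
qed

theorem char_fun_unique:
  fixes \<mu> \<nu> :: "(real^'n) measure"
  assumes \<mu>: "prob_space \<mu>" "sets \<mu> = sets borel" and \<nu>: "prob_space \<nu>" "sets \<nu> = sets borel"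
    and eq: "\<And>u. char_fun \<mu> (\<lambda>x. x) u = char_fun \<nu> (\<lambda>x. x) u"
  shows "\<mu> = \<nu>"
proof -
  interpret \<mu>: prob_space \<mu> by fact
  interpret \<nu>: prob_space \<nu> by fact
  note [measurable_cong] = \<mu>(2) \<nu>(2)
  have box: "emeasure \<mu> (box a b) = emeasure \<nu> (box a b)" for a b :: "real^'n"
  proof -
    have ind: "(\<Prod>i\<in>UNIV. indicator {a $ i<..<b $ i} (x $ i) :: real) = indicator (box a b) x" for x
      by (auto simp: indicator_def box_def Basis_vec_def inner_axis prod_zero_iff)
    have "measure \<mu> (box a b) = measure \<nu> (box a b)"
      using char_fun_determines_box_weights[OF \<mu> \<nu> eq, of "\<lambda>i. {a $ i<..<b $ i}" UNIV 0]
      by (simp add: ind scaleR_conv_of_real)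
    then show ?thesis by (simp add: \<mu>.emeasure_eq_measure \<nu>.emeasure_eq_measure)
  qed
  show ?thesis
  proof (rule measure_eqI_generator_eq[where E = "range (\<lambda>(a, b). box a b)" and \<Omega> = UNIV])
    show "Int_stable (range (\<lambda>(a, b). box a b :: (real^'n) set))"
      by (auto simp: Int_stable_def box_Int_box)
    show "sets \<mu> = sigma_sets UNIV (range (\<lambda>(a, b). box a b))" "sets \<nu> = sigma_sets UNIV (range (\<lambda>(a, b). box a b))"
      using \<mu> \<nu> by (simp_all add: borel_eq_box)
    show "range (\<lambda>n::nat. box (- (real n *\<^sub>R One)) (real n *\<^sub>R One)) \<subseteq> range (\<lambda>(a, b). box a b :: (real^'n) set)" by auto
    show "(\<Union>n::nat. box (- (real n *\<^sub>R One)) (real n *\<^sub>R One)) = (UNIV :: (real^'n) set)" by (rule UN_box_eq_UNIV)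
    show "emeasure \<mu> X = emeasure \<nu> X" if "X \<in> range (\<lambda>(a, b). box a b)" for X using that box by auto
  qed auto
qed

section \<open>Positive stable variables\<close>

lemma gbinomial_alternating_nonneg:
  fixes \<beta> :: real
  assumes "0 < \<beta>" "\<beta> < 1"
  shows "0 \<le> - ((-1) ^ Suc k * (\<beta> gchoose Suc k))"
proof (induction k)
  case 0
  then show ?case using assms by simp
next
  case (Suc k)
  have "real (Suc (Suc k)) * (\<beta> gchoose Suc (Suc k)) = (\<beta> - real (Suc k)) * (\<beta> gchoose Suc k)"
    using gbinomial_mult_1[of \<beta> "Suc k"] by (simp add: algebra_simps)
  then have rec: "(\<beta> gchoose Suc (Suc k)) = - ((real (Suc k) - \<beta>) / real (Suc (Suc k))) * (\<beta> gchoose Suc k)"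
    by (simp add: field_simps)
  have "- ((-1) ^ Suc (Suc k) * (\<beta> gchoose Suc (Suc k))) =
      (real (Suc k) - \<beta>) / real (Suc (Suc k)) * (- ((-1) ^ Suc k * (\<beta> gchoose Suc k)))"
    unfolding rec power_Suc[of _ "Suc k"] by (simp only: mult_minus_left mult_minus_right mult_1 ac_simps minus_minus)
  also have "\<dots> \<ge> 0" using Suc assms by (intro mult_nonneg_nonneg) auto
  finally show ?case .
qed

text \<open>The Sibuya distribution: by the binomial series, \<open>1 - (1 - z) powr \<beta>\<close> is a power series with
  nonnegative coefficients. Letting \<open>z\<close> tend to \<open>1\<close> from the left, first in the partial sums and then
  in the whole series, shows that the coefficients sum to \<open>1\<close>.\<close>

lemma sibuya_pmf_exists:
  fixes \<beta> :: real
  assumes \<beta>: "0 < \<beta>" "\<beta> < 1"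
  shows "\<exists>p :: nat pmf. \<forall>z\<in>{0..<1}. (\<integral>\<^sup>+k. ennreal (z ^ k) \<partial>p) = ennreal (1 - (1 - z) powr \<beta>)"
proof -
  define f where "f k = (if k = 0 then 0 else - ((-1) ^ k * (\<beta> gchoose k)))" for k
  have f0: "0 \<le> f k" for k
    using gbinomial_alternating_nonneg[OF \<beta>, of "k - 1"] by (cases k) (auto simp: f_def)
  have gf: "(\<lambda>k. f k * z ^ k) sums (1 - (1 - z) powr \<beta>)" if "\<bar>z\<bar> < 1" for z
  proof -
    have "(\<lambda>k. (\<beta> gchoose k) * (- z) ^ k) sums (1 + - z) powr \<beta>"
      using that by (intro gen_binomial_real) simp
    from sums_diff[OF sums_single[of 0 "\<lambda>_. 1"] this]
    have "(\<lambda>k. (if k = 0 then 1 else 0) - (\<beta> gchoose k) * (- z) ^ k) sums (1 - (1 - z) powr \<beta>)" by simp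
    also have "(\<lambda>k. (if k = 0 then 1 else 0) - (\<beta> gchoose k) * (- z) ^ k) = (\<lambda>k. f k * z ^ k)"
      by (auto simp: f_def power_minus[of z] fun_eq_iff)
    finally show ?thesis .
  qed
  have lim: "((\<lambda>z. (1 - z) powr \<beta>) \<longlongrightarrow> 0) (at_left (1::real))"
  proof -
    have "((\<lambda>z. (1 - z) powr \<beta>) \<longlongrightarrow> 0 powr \<beta>) (at_left (1::real))"
      using \<beta> by (intro tendsto_powr' tendsto_eq_intros) (auto simp: eventually_at_filter)
    then show ?thesis by simp
  qed
  have ev: "eventually (\<lambda>z. 0 < z \<and> z < 1) (at_left (1::real))"
    using eventually_at_left_real[of 0 1] by simp
  have partial: "sum f {..<m} \<le> 1" for m
  proof (rule tendsto_le)
    show "((\<lambda>z. \<Sum>k<m. f k * z ^ k) \<longlongrightarrow> sum f {..<m}) (at_left 1)"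
      by (rule tendsto_eq_intros refl)+ simp
    show "eventually (\<lambda>z. (\<Sum>k<m. f k * z ^ k) \<le> 1) (at_left 1)"
      using ev
    proof eventually_elim
      case (elim z)
      then have "(\<Sum>k<m. f k * z ^ k) \<le> 1 - (1 - z) powr \<beta>"
        using gf[of z] f0 sum_le_suminf[of "\<lambda>k. f k * z ^ k" "{..<m}"] by (simp add: sums_iff)
      also have "\<dots> \<le> 1" by simp
      finally show ?case .
    qed
  qed (auto intro: tendsto_const)
  have sumf: "summable f" using f0 partial by (intro summableI_nonneg_bounded[where x=1])
  have "suminf f \<le> 1" using partial sumf by (intro suminf_le_const)
  moreover have "1 \<le> suminf f"
  proof (rule tendsto_le)
    show "((\<lambda>z. 1 - (1 - z) powr \<beta>) \<longlongrightarrow> 1) (at_left 1)"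
      using tendsto_diff[OF tendsto_const lim, of 1] by simp
    show "eventually (\<lambda>z. 1 - (1 - z) powr \<beta> \<le> suminf f) (at_left 1)"
      using ev
    proof eventually_elim
      case (elim z)
      then have "(\<Sum>k. f k * z ^ k) \<le> suminf f"
        using gf[of z] f0 sumf by (intro suminf_le) (auto simp: sums_iff mult_left_le power_le_one)
      then show ?case using gf[of z] elim by (simp add: sums_iff)
    qed
  qed (auto intro: tendsto_const)
  ultimately have "suminf f = 1" by simp
  then have one: "(\<integral>\<^sup>+k. ennreal (f k) \<partial>count_space UNIV) = 1"
    using f0 sumf by (simp add: nn_integral_count_space_nat suminf_ennreal2)
  have "(\<integral>\<^sup>+k. ennreal (z ^ k) \<partial>embed_pmf f) = ennreal (1 - (1 - z) powr \<beta>)" if "z \<in> {0..<1}" for z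
  proof -
    have "(\<integral>\<^sup>+k. ennreal (z ^ k) \<partial>embed_pmf f) = (\<integral>\<^sup>+k. ennreal (f k * z ^ k) \<partial>count_space UNIV)"
      using f0 that by (simp add: nn_integral_measure_pmf pmf_embed_pmf[OF f0 one] ennreal_mult)
    also have "\<dots> = ennreal (1 - (1 - z) powr \<beta>)"
      using gf[of z] f0 that by (auto simp: nn_integral_count_space_nat suminf_ennreal2 sums_iff)
    finally show ?thesis .
  qed
  then show ?thesis by blast
qed

text \<open>The distribution \<open>q\<close> is that of the sum of \<open>n\<close> independent draws from \<open>p\<close>.\<close>

lemma pmf_generating_function_power:
  fixes p :: "nat pmf"
  shows "\<exists>q :: nat pmf. \<forall>z\<ge>0. (\<integral>\<^sup>+k. ennreal (z ^ k) \<partial>q) = (\<integral>\<^sup>+k. ennreal (z ^ k) \<partial>p) ^ n"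
proof (induction n)
  case 0
  show ?case by (rule exI[of _ "return_pmf 0"]) simp
next
  case (Suc n)
  then obtain q :: "nat pmf" where q: "\<And>z. 0 \<le> z \<Longrightarrow> (\<integral>\<^sup>+k. ennreal (z ^ k) \<partial>q) = (\<integral>\<^sup>+k. ennreal (z ^ k) \<partial>p) ^ n"
    by blast
  have "(\<integral>\<^sup>+k. ennreal (z ^ k) \<partial>bind_pmf p (\<lambda>a. map_pmf ((+) a) q)) = (\<integral>\<^sup>+k. ennreal (z ^ k) \<partial>p) ^ Suc n"
    if "0 \<le> z" for z
    using that by (simp add: power_add ennreal_mult nn_integral_cmult nn_integral_multc q)
  then show ?case by blast
qed

text \<open>The power on the right is the Laplace transform at \<open>s\<close> of a sum of \<open>Suc m\<close> independent Sibuya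
  variables scaled by \<open>Suc m powr (- 1 / \<beta>)\<close>. A lower bound that does not involve \<open>m\<close> yields tightness,
  and the limit in the lemma after it identifies the weak limit.\<close>

lemma sibuya_sum_bound:
  fixes s \<beta> :: real and m :: nat
  assumes "0 < \<beta>" "0 < s"
  defines "y \<equiv> (1 - exp (- s * real (Suc m) powr (- 1 / \<beta>))) powr \<beta>"
  shows "1 - s powr \<beta> \<le> (1 - y) ^ Suc m"
proof -
  let ?c = "real (Suc m) powr (- 1 / \<beta>)"
  have "0 \<le> 1 - exp (- s * ?c)" using assms by simp
  have "1 - exp (- s * ?c) \<le> s * ?c" using exp_ge_add_one_self[of "- s * ?c"] by simp
  then have "y \<le> (s * ?c) powr \<beta>" unfolding y_def using assms by (intro powr_mono2) auto
  also have "\<dots> = s powr \<beta> * ?c powr \<beta>" by (rule powr_mult)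
  also have "?c powr \<beta> = 1 / real (Suc m)"
    using assms by (simp only: powr_powr) (simp add: powr_minus_divide)
  finally have "real (Suc m) * y \<le> s powr \<beta>" by (simp add: field_simps del: of_nat_Suc)
  moreover have "y \<le> 1" unfolding y_def using assms powr_mono2[of \<beta> "1 - exp (- s * ?c)" 1] by simp
  then have "1 - real (Suc m) * y \<le> (1 - y) ^ Suc m" using Bernoulli_inequality[of "- y" "Suc m"] by simp
  ultimately show ?thesis by linarith
qed

lemma sibuya_sum_limit:
  fixes s \<beta> :: real
  assumes "0 < \<beta>" "0 < s"
  shows "(\<lambda>n. (1 - (1 - exp (- s * real n powr (- 1 / \<beta>))) powr \<beta>) ^ n) \<longlonglongrightarrow> exp (- (s powr \<beta>))"
  using assms by real_asymp

text \<open>This is Markov's inequality for \<open>1 - exp (- \<bar>x\<bar> / R)\<close>, which is at least \<open>1 - exp (-1)\<close> outside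
  the interval.\<close>

lemma laplace_tail_bound:
  assumes "real_distribution M" "0 < R"
  shows "(1 - exp (-1)) * (1 - measure M {-R<..R}) \<le> 1 - (LINT x|M. exp (- (1 / R) * \<bar>x\<bar>))"
proof -
  interpret M: real_distribution M by fact
  have int: "integrable M (\<lambda>x. exp (- (1 / R) * \<bar>x\<bar>))"
    using assms by (intro M.integrable_const_bound[where B=1]) auto
  have one: "measure M UNIV = 1" using M.prob_space by simp
  have ind: "integrable M (indicator {-R<..R} :: real \<Rightarrow> real)"
    by (intro M.integrable_const_bound[where B=1]) (auto simp: indicator_def)
  have "(1 - exp (-1)) * (1 - measure M {-R<..R}) = (LINT x|M. (1 - exp (-1)) * (1 - indicator {-R<..R} x))"
    by (subst integral_mult_right_zero, subst Bochner_Integration.integral_diff) (simp_all add: one ind)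
  also have "\<dots> \<le> (LINT x|M. 1 - exp (- (1 / R) * \<bar>x\<bar>))"
  proof (rule integral_mono)
    show "(1 - exp (- 1)) * (1 - indicator {-R<..R} x) \<le> 1 - exp (- (1 / R) * \<bar>x\<bar>)" for x
    proof (cases "x \<in> {-R<..R}")
      case False
      then have "1 \<le> \<bar>x\<bar> / R" using assms by auto
      then show ?thesis using False by simp
    qed (use assms in auto)
  qed (use int in \<open>auto intro!: M.integrable_const_bound[where B=2] simp: indicator_def\<close>)
  also have "\<dots> = 1 - (LINT x|M. exp (- (1 / R) * \<bar>x\<bar>))" using int by (simp add: one)
  finally show ?thesis .
qed

text \<open>The variable \<open>\<bar>x\<bar>\<close> under \<open>M\<close> is a positive \<open>\<beta>\<close>-stable variable. It is obtained as a weak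
  subsequential limit of normalised sums of Sibuya variables. Writing the transform with \<open>\<bar>x\<bar>\<close> makes
  the integrand bounded and continuous on the whole line, so that weak convergence applies and the
  support of the limit need not be examined.\<close>

lemma positive_stable_exists:
  fixes \<beta> :: real
  assumes \<beta>: "0 < \<beta>" "\<beta> < 1"
  shows "\<exists>M. real_distribution M \<and> (\<forall>s\<ge>0. (LINT x|M. exp (- s * \<bar>x\<bar>)) = exp (- (s powr \<beta>)))"
proof -
  obtain p :: "nat pmf" where p: "\<And>z. 0 \<le> z \<Longrightarrow> z < 1 \<Longrightarrow> (\<integral>\<^sup>+k. ennreal (z ^ k) \<partial>p) = ennreal (1 - (1 - z) powr \<beta>)"
    using sibuya_pmf_exists[OF \<beta>] by (metis atLeastLessThan_iff)
  obtain q :: "nat \<Rightarrow> nat pmf" where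
    q: "\<And>n z. 0 \<le> z \<Longrightarrow> (\<integral>\<^sup>+k. ennreal (z ^ k) \<partial>q n) = (\<integral>\<^sup>+k. ennreal (z ^ k) \<partial>p) ^ n"
    using pmf_generating_function_power[of p] by metis
  define c where "c n = real n powr (- 1 / \<beta>)" for n
  define X where "X m = distr (q (Suc m)) borel (\<lambda>k. real k * c (Suc m))" for m
  have rd: "real_distribution (X m)" for m
    unfolding X_def by (intro real_distribution.intro real_distribution_axioms.intro prob_space.prob_space_distr)
      (auto intro: prob_space_measure_pmf)
  have L: "(LINT x|X m. exp (- s * \<bar>x\<bar>)) = (1 - (1 - exp (- s * c (Suc m))) powr \<beta>) ^ Suc m" if "0 < s" for s m
  proof -
    have c0: "0 < c (Suc m)" by (simp add: c_def)
    define z where "z = exp (- s * c (Suc m))"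
    have z: "0 \<le> z" "z < 1" using that c0 by (auto simp: z_def)
    have "(LINT x|X m. exp (- s * \<bar>x\<bar>)) = (LINT k|q (Suc m). exp (- s * \<bar>real k * c (Suc m)\<bar>))"
      unfolding X_def by (subst integral_distr) auto
    also have "\<dots> = (LINT k|q (Suc m). z ^ k)"
      unfolding z_def using c0 by (simp add: abs_mult exp_of_nat_mult[symmetric] algebra_simps)
    also have "\<dots> = (1 - (1 - z) powr \<beta>) ^ Suc m"
    proof (subst integral_eq_nn_integral)
      have "(1 - z) powr \<beta> \<le> 1" using z \<beta> powr_mono2[of \<beta> "1 - z" 1] by simp
      then show "enn2real (\<integral>\<^sup>+k. ennreal (z ^ k) \<partial>q (Suc m)) = (1 - (1 - z) powr \<beta>) ^ Suc m"
        unfolding q[OF z(1)] p[OF z] by (subst ennreal_power) (auto simp del: power_Suc)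
    qed (use z in auto)
    finally show ?thesis unfolding z_def .
  qed
  have "tight X"
    unfolding tight_def
  proof (intro conjI allI impI rd)
    fix \<epsilon> :: real assume "0 < \<epsilon>"
    define \<delta> where "\<delta> = \<epsilon> * (1 - exp (- 1)) / 2"
    have \<delta>: "0 < \<delta>" using \<open>0 < \<epsilon>\<close> by (simp add: \<delta>_def)
    \<comment> \<open>This radius solves \<open>(1 / R) powr \<beta> = \<delta>\<close>, the value of the uniform bound at \<open>s = 1 / R\<close>.\<close>
    define R where "R = \<delta> powr (- 1 / \<beta>)"
    have R: "0 < R" using \<delta> by (simp add: R_def)
    have "(1 / R) powr \<beta> = \<delta>"
    proof -
      have "R powr \<beta> = 1 / \<delta>" unfolding R_def powr_powr using \<delta> \<beta> by (simp add: powr_minus_divide)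
      then show ?thesis by (simp add: powr_divide)
    qed
    have "1 - \<epsilon> < measure (X m) {-R<..R}" for m
    proof -
      have "(1 - exp (-1)) * (1 - measure (X m) {-R<..R}) \<le> 1 - (LINT x|X m. exp (- (1 / R) * \<bar>x\<bar>))"
        by (rule laplace_tail_bound[OF rd R])
      also have "\<dots> \<le> (1 / R) powr \<beta>"
        using sibuya_sum_bound[of \<beta> "1 / R" m] L[of "1 / R" m] R \<beta> unfolding c_def by simp
      also have "\<dots> = \<delta>" by fact
      also have "\<dots> < (1 - exp (-1)) * \<epsilon>" using \<open>0 < \<epsilon>\<close> by (simp add: \<delta>_def)
      finally have "1 - measure (X m) {-R<..R} < \<epsilon>" by (rule mult_left_less_imp_less) simp
      then show ?thesis by simp
    qed
    then show "\<exists>a b. a < b \<and> (\<forall>m. 1 - \<epsilon> < measure (X m) {a<..b})"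
      using R by (intro exI[of _ "-R"] exI[of _ R]) auto
  qed
  from tight_imp_convergent_subsubsequence[OF this strict_mono_id]
  obtain r M where r: "strict_mono r" and M: "real_distribution M" "weak_conv_m (X \<circ> r) M"
    by (auto simp: o_def)
  have "(LINT x|M. exp (- s * \<bar>x\<bar>)) = exp (- (s powr \<beta>))" if "0 \<le> s" for s
  proof (cases "s = 0")
    case True
    interpret real_distribution M by fact
    show ?thesis using True prob_space by simp
  next
    case False
    then have "0 < s" using that by simp
    have "(\<lambda>m. LINT x|X (r m). exp (- s * \<bar>x\<bar>)) \<longlonglongrightarrow> (LINT x|M. exp (- s * \<bar>x\<bar>))"
      using M rd \<open>0 < s\<close>
      by (intro weak_conv_imp_integral_bdd_continuous_conv[where \<mu> = "\<lambda>m. X (r m)" and B = 1])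
        (auto simp: o_def intro!: continuous_intros)
    moreover have "(\<lambda>m. LINT x|X m. exp (- s * \<bar>x\<bar>)) \<longlonglongrightarrow> exp (- (s powr \<beta>))"
      unfolding L[OF \<open>0 < s\<close>] c_def by (rule LIMSEQ_Suc[OF sibuya_sum_limit]) fact+
    then have "(\<lambda>m. LINT x|X (r m). exp (- s * \<bar>x\<bar>)) \<longlonglongrightarrow> exp (- (s powr \<beta>))"
      using LIMSEQ_subseq_LIMSEQ[OF _ r] by (fastforce simp: o_def)
    ultimately show ?thesis by (rule LIMSEQ_unique)
  qed
  with M show ?thesis by blast
qed

section \<open>Sub-Gaussian stable vectors\<close>

lemma char_fun_distr:
  fixes f :: "'s \<Rightarrow> 'a::euclidean_space"
  assumes [measurable]: "f \<in> borel_measurable M"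
  shows "char_fun (distr M borel f) (\<lambda>x. x) u = char_fun M f u"
  unfolding char_fun_def by (subst integral_distr) auto

lemma standard_gaussian_exists:
  "\<exists>\<Gamma> :: (real^'n) measure. prob_space \<Gamma> \<and> sets \<Gamma> = sets borel \<and>
     (\<forall>u. char_fun \<Gamma> (\<lambda>x. x) u = complex_of_real (exp (- ((norm u)\<^sup>2 / 2))))"
proof -
  define P :: "('n \<Rightarrow> real) measure" where "P = (\<Pi>\<^sub>M i\<in>UNIV. std_normal_distribution)"
  interpret S: real_distribution std_normal_distribution by (rule real_dist_normal_dist)
  interpret P: product_prob_space "\<lambda>_::'n. std_normal_distribution" UNIV
    by unfold_locales
  have comp[measurable]: "(\<lambda>f. f i) \<in> borel_measurable P" for i
    using measurable_component_singleton[of i UNIV "\<lambda>_. std_normal_distribution"]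
    unfolding P_def by (simp cong: measurable_cong_sets)
  have vec[measurable]: "(\<lambda>f. \<chi> i. f i) \<in> borel_measurable P"
    by (subst borel_measurable_euclidean_space) (auto simp: Basis_vec_def inner_axis)
  define \<Gamma> :: "(real^'n) measure" where "\<Gamma> = distr P borel (\<lambda>f. \<chi> i. f i)"
  have "prob_space \<Gamma>" unfolding \<Gamma>_def P_def[symmetric]
    by (rule prob_space.prob_space_distr[OF _ vec]) (simp add: P_def P.prob_space_axioms)
  moreover have "char_fun \<Gamma> (\<lambda>x. x) u = complex_of_real (exp (- ((norm u)\<^sup>2 / 2)))" for u
  proof -
    have "char_fun \<Gamma> (\<lambda>x. x) u = (CLINT f|P. iexp (\<Sum>i\<in>UNIV. u $ i * f i))"
      unfolding \<Gamma>_def char_fun_distr[OF vec] unfolding char_fun_def by (simp add: inner_vec_def mult.commute)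
    also have "\<dots> = (CLINT f|P. (\<Prod>i\<in>UNIV. iexp (u $ i * f i)))"
      by (simp add: sum_distrib_left exp_sum)
    also have "\<dots> = (\<Prod>i\<in>UNIV. (CLINT x|std_normal_distribution. iexp (u $ i * x)))"
      unfolding P_def by (intro P.product_integral_prod S.integrable_iexp) auto
    also have "\<dots> = (\<Prod>i\<in>UNIV. complex_of_real (exp (- ((u $ i)\<^sup>2) / 2)))"
      using char_std_normal_distribution by (simp add: char_def fun_eq_iff)
    also have "\<dots> = complex_of_real (exp (\<Sum>i\<in>UNIV. - ((u $ i)\<^sup>2) / 2))"
      by (simp add: exp_sum)
    also have "(\<Sum>i\<in>UNIV. - ((u $ i)\<^sup>2) / 2) = - ((norm u)\<^sup>2 / 2)"
      unfolding dot_square_norm[symmetric] inner_vec_def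
      by (simp add: sum_negf sum_divide_distrib power2_eq_square)
    finally show ?thesis .
  qed
  ultimately show ?thesis by (intro exI[of _ \<Gamma>]) (simp add: \<Gamma>_def)
qed

lemma norm_square_powr_half: "((norm w)\<^sup>2) powr (\<alpha> / 2) = norm w powr \<alpha>"
  by (cases "w = 0") (simp_all add: powr_powr flip: powr_numeral)

text \<open>If \<open>A\<close> is positive \<open>(\<alpha> / 2)\<close>-stable and \<open>g\<close> is an independent standard Gaussian vector, then
  conditionally on \<open>A\<close> the vector \<open>sqrt (2 * A) *\<^sub>R (B *v g)\<close> is Gaussian with characteristic function
  \<open>exp (- A * (norm (transpose B *v u))\<^sup>2)\<close>. Integrating over \<open>A\<close> gives the Laplace transform of \<open>A\<close>
  at \<open>(norm (transpose B *v u))\<^sup>2\<close>.\<close>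

lemma gaussian_mixture_exists:
  fixes B :: "real^'n^'n" and \<alpha> :: real
  assumes \<alpha>: "0 < \<alpha>" "\<alpha> < 2"
  shows "\<exists>N :: (real^'n) measure. prob_space N \<and> sets N = sets borel \<and>
     (\<forall>u. char_fun N (\<lambda>x. x) u = complex_of_real (exp (- (norm (transpose B *v u) powr \<alpha>))))"
proof -
  obtain X where X: "real_distribution X"
    and LX: "\<And>s. 0 \<le> s \<Longrightarrow> (LINT x|X. exp (- s * \<bar>x\<bar>)) = exp (- (s powr (\<alpha> / 2)))"
    using positive_stable_exists[of "\<alpha> / 2"] \<alpha> by auto
  obtain \<Gamma> :: "(real^'n) measure" where \<Gamma>: "prob_space \<Gamma>" "sets \<Gamma> = sets borel"
    and C\<Gamma>: "\<And>u. char_fun \<Gamma> (\<lambda>x. x) u = complex_of_real (exp (- ((norm u)\<^sup>2 / 2)))"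
    using standard_gaussian_exists by blast
  interpret X: real_distribution X by fact
  interpret \<Gamma>: prob_space \<Gamma> by fact
  interpret X\<Gamma>: pair_prob_space X \<Gamma> ..
  note [measurable_cong] = \<Gamma>(2)
  have [measurable]: "(\<lambda>g. B *v g) \<in> borel_measurable borel"
    by (intro borel_measurable_continuous_onI linear_continuous_on matrix_vector_mul_bounded_linear)
  define F where "F = (\<lambda>(x, g). sqrt (2 * \<bar>x\<bar>) *\<^sub>R (B *v g))"
  have F[measurable]: "F \<in> borel_measurable (X \<Otimes>\<^sub>M \<Gamma>)" unfolding F_def by measurable
  define N where "N = distr (X \<Otimes>\<^sub>M \<Gamma>) borel F"
  have "prob_space N" unfolding N_def by (rule X\<Gamma>.prob_space_distr[OF F])
  moreover have "char_fun N (\<lambda>x. x) u = complex_of_real (exp (- (norm (transpose B *v u) powr \<alpha>)))" for u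
  proof -
    define w where "w = transpose B *v u"
    have adj: "F (x, g) \<bullet> u = g \<bullet> (sqrt (2 * \<bar>x\<bar>) *\<^sub>R w)" for x g
      using inner_matrix_adjoint[of B g u] by (simp only: F_def w_def prod.case inner_scaleR_left inner_scaleR_right)
    have "char_fun N (\<lambda>x. x) u = (CLINT p|(X \<Otimes>\<^sub>M \<Gamma>). iexp (F p \<bullet> u))"
      unfolding N_def char_fun_distr[OF F] unfolding char_fun_def ..
    also have "\<dots> = (CLINT x|X. CLINT g|\<Gamma>. iexp (F (x, g) \<bullet> u))"
      by (rule X\<Gamma>.integral_fst'[symmetric]) (intro X\<Gamma>.integrable_iexp; measurable)
    also have "\<dots> = (CLINT x|X. char_fun \<Gamma> (\<lambda>x. x) (sqrt (2 * \<bar>x\<bar>) *\<^sub>R w))"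
      unfolding char_fun_def adj ..
    also have "\<dots> = (CLINT x|X. complex_of_real (exp (- ((norm w)\<^sup>2) * \<bar>x\<bar>)))"
      unfolding C\<Gamma> by (simp add: power_mult_distrib mult.commute)
    also have "\<dots> = complex_of_real (LINT x|X. exp (- ((norm w)\<^sup>2) * \<bar>x\<bar>))" by (rule integral_complex_of_real)
    also have "\<dots> = complex_of_real (exp (- (((norm w)\<^sup>2) powr (\<alpha> / 2))))" by (subst LX) auto
    finally show ?thesis unfolding w_def norm_square_powr_half .
  qed
  ultimately show ?thesis by (intro exI[of _ N]) (simp add: N_def)
qed

text \<open>Both sides of each distributional identity have the same characteristic function: evenness of
  \<open>q\<close> gives symmetry, and homogeneity turns the product of the two factors for \<open>a\<close> and \<open>b\<close> into the
  factor for \<open>a + b\<close>.\<close>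

lemma sas_of_char_fun:
  fixes N :: "(real^'n) measure" and q :: "real^'n \<Rightarrow> real"
  assumes N: "prob_space N" "sets N = sets borel"
    and cf: "\<And>u. char_fun N (\<lambda>x. x) u = complex_of_real (exp (- q u))"
    and even: "\<And>u. q (- u) = q u" and hom: "\<And>c u. 0 < c \<Longrightarrow> q (c *\<^sub>R u) = c powr \<alpha> * q u"
    and "\<alpha> \<noteq> 0"
  shows "sas \<alpha> N (\<lambda>x. x)"
proof -
  interpret N: prob_space N by fact
  interpret NN: pair_prob_space N N ..
  note [measurable_cong] = N(2)
  have cf_scale: "(CLINT x|N. iexp ((c *\<^sub>R x) \<bullet> u)) = complex_of_real (exp (- q (c *\<^sub>R u)))" for c u
    using cf[of "c *\<^sub>R u"] by (simp add: char_fun_def)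
  have "distr N borel (\<lambda>x. x) = distr N borel (\<lambda>x. - x)"
  proof (rule char_fun_unique)
    fix u
    have "char_fun N (\<lambda>x. - x) u = char_fun N (\<lambda>x. x) (- u)" by (simp add: char_fun_def)
    then show "char_fun (distr N borel (\<lambda>x. x)) (\<lambda>x. x) u = char_fun (distr N borel (\<lambda>x. - x)) (\<lambda>x. x) u"
      by (simp add: char_fun_distr cf even)
  qed (auto intro!: N.prob_space_distr)
  moreover have "distr (N \<Otimes>\<^sub>M N) borel (\<lambda>(s, t). a powr (1 / \<alpha>) *\<^sub>R s + b powr (1 / \<alpha>) *\<^sub>R t) =
      distr N borel (\<lambda>s. (a + b) powr (1 / \<alpha>) *\<^sub>R s)" if ab: "0 < a" "0 < b" for a b
  proof (rule char_fun_unique)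
    fix u
    let ?S = "\<lambda>(s, t). a powr (1 / \<alpha>) *\<^sub>R s + b powr (1 / \<alpha>) *\<^sub>R (t :: real^'n)"
    have q: "q (c powr (1 / \<alpha>) *\<^sub>R u) = c * q u" if "0 < c" for c
      using that \<open>\<alpha> \<noteq> 0\<close> by (simp add: hom powr_powr)
    have "char_fun (N \<Otimes>\<^sub>M N) ?S u = (CLINT s|N. CLINT t|N. iexp (?S (s, t) \<bullet> u))"
      unfolding char_fun_def by (rule NN.integral_fst'[symmetric]) (intro NN.integrable_iexp; measurable)
    also have "\<dots> = (CLINT s|N. CLINT t|N. iexp ((a powr (1 / \<alpha>) *\<^sub>R s) \<bullet> u) * iexp ((b powr (1 / \<alpha>) *\<^sub>R t) \<bullet> u))"
      by (simp add: inner_add_left distrib_left exp_add)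
    also have "\<dots> = complex_of_real (exp (- q (a powr (1 / \<alpha>) *\<^sub>R u))) * complex_of_real (exp (- q (b powr (1 / \<alpha>) *\<^sub>R u)))"
      unfolding integral_mult_right_zero integral_mult_left_zero cf_scale ..
    also have "\<dots> = complex_of_real (exp (- q ((a + b) powr (1 / \<alpha>) *\<^sub>R u)))"
      using ab q[of a] q[of b] q[of "a + b"] by (simp add: algebra_simps flip: exp_add of_real_mult)
    also have "\<dots> = char_fun N (\<lambda>s. (a + b) powr (1 / \<alpha>) *\<^sub>R s) u"
      unfolding char_fun_def cf_scale ..
    finally show "char_fun (distr (N \<Otimes>\<^sub>M N) borel ?S) (\<lambda>x. x) u =
        char_fun (distr N borel (\<lambda>s. (a + b) powr (1 / \<alpha>) *\<^sub>R s)) (\<lambda>x. x) u"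
      by (simp add: char_fun_distr)
  qed (auto intro!: N.prob_space_distr NN.prob_space_distr)
  ultimately show ?thesis unfolding sas_def using N by auto
qed

lemma sub_gaussian_exists:
  fixes B :: "real^'n^'n" and \<alpha> :: real
  assumes \<alpha>: "0 < \<alpha>" "\<alpha> < 2"
  shows "\<exists>N :: (real^'n) measure. sub_gaussian \<alpha> N (\<lambda>x. x) \<and>
     (\<forall>u. char_fun N (\<lambda>x. x) u = complex_of_real (exp (- (norm (transpose B *v u) powr \<alpha>))))"
proof -
  obtain N :: "(real^'n) measure" where N: "prob_space N" "sets N = sets borel"
    and cf: "\<And>u. char_fun N (\<lambda>x. x) u = complex_of_real (exp (- (norm (transpose B *v u) powr \<alpha>)))"
    using gaussian_mixture_exists[OF \<alpha>] by blast
  have "sas \<alpha> N (\<lambda>x. x)"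
  proof (rule sas_of_char_fun[OF N cf])
    show "norm (transpose B *v (- u)) powr \<alpha> = norm (transpose B *v u) powr \<alpha>" for u
      using vec.neg[of "transpose B" u] by (simp only: norm_minus_cancel)
    show "norm (transpose B *v (c *\<^sub>R u)) powr \<alpha> = c powr \<alpha> * norm (transpose B *v u) powr \<alpha>" if "0 < c" for c u
      unfolding matrix_vector_mult_scaleR norm_scaleR using that by (simp add: powr_mult)
  qed (use \<alpha> in auto)
  moreover have C: "((B ** transpose B) *v u) \<bullet> u = (norm (transpose B *v u))\<^sup>2" for u
    unfolding dot_square_norm[symmetric] matrix_vector_mul_assoc[symmetric]
    by (rule inner_matrix_adjoint)
  ultimately have "sub_gaussian \<alpha> N (\<lambda>x. x)"
    unfolding sub_gaussian_def
    by (intro conjI exI[of _ "B ** transpose B"]) (simp_all only: C cf matrix_transpose_mul transpose_transpose norm_square_powr_half, simp_all)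
  with cf show ?thesis by blast
qed

section \<open>Approximation by a sub-Gaussian vector\<close>

theorem theorem5p2:
  fixes \<alpha> :: real and M :: "'s measure" and \<xi> :: "'s \<Rightarrow> real ^ 'n" and K :: "(real ^ 'n) set"
  assumes "1 \<le> \<alpha>" and "\<alpha> < 2"
    and "sas \<alpha> M \<xi>"
    and "associated_zonoid \<alpha> M \<xi> K"
  shows "\<exists>(N :: (real ^ 'n) measure) (\<eta> :: real ^ 'n \<Rightarrow> real ^ 'n).
    sub_gaussian \<alpha> N \<eta> \<and>
    m_dist \<alpha> M \<xi> N \<eta> \<le> ereal ((real CARD('n) powr (\<alpha> / 2) - 1) * set_norm K powr \<alpha>)"
proof -
  let ?h = "support_fun K"
  have K: "K \<noteq> {}" "compact K" "uminus ` K = K"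
    and cf\<xi>: "\<And>u. char_fun M \<xi> u = complex_of_real (exp (- (?h u powr \<alpha>)))"
    using assms(4) unfolding associated_zonoid_def spectral_measure_def by auto
  have bdd: "bdd_above ((\<lambda>x. x \<bullet> u) ` K)" for u
    using K by (intro bounded_imp_bdd_above compact_imp_bounded compact_continuous_image continuous_intros)
  have upper: "\<bar>x \<bullet> v\<bar> \<le> ?h v" if "x \<in> K" for x v
  proof -
    have "x \<bullet> v \<le> ?h v" unfolding support_fun_def by (rule cSUP_upper[OF that bdd])
    moreover have "- x \<in> K" using K(3) that by (metis imageI)
    then have "(- x) \<bullet> v \<le> ?h v" unfolding support_fun_def by (rule cSUP_upper[OF _ bdd])
    ultimately show ?thesis by simp
  qed
  have "\<exists>x. x \<bullet> u = ?h u \<and> (\<forall>v. \<bar>x \<bullet> v\<bar> \<le> ?h v)" for u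
  proof -
    have "continuous_on K (\<lambda>x. x \<bullet> u)" by (intro continuous_intros)
    then obtain x where x: "x \<in> K" "\<And>y. y \<in> K \<Longrightarrow> y \<bullet> u \<le> x \<bullet> u"
      using continuous_attains_sup[OF K(2,1)] by blast
    have "?h u = x \<bullet> u" unfolding support_fun_def
      using x by (intro cSup_eq_maximum) auto
    with upper[OF x(1)] show ?thesis by auto
  qed
  from john_symmetric_ellipsoid[of ?h, OF this] obtain B :: "real^'n^'n" where
    B1: "\<And>u. norm (transpose B *v u) \<le> ?h u" and
    B2: "\<And>u. ?h u \<le> sqrt CARD('n) * norm (transpose B *v u)" by blast
  obtain N :: "(real^'n) measure" where N: "sub_gaussian \<alpha> N (\<lambda>x. x)"
    and cf: "\<And>u. char_fun N (\<lambda>x. x) u = complex_of_real (exp (- (norm (transpose B *v u) powr \<alpha>)))"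
    using sub_gaussian_exists[of \<alpha> B] assms by auto
  have bddn: "bdd_above (norm ` K)"
    using K by (intro bounded_imp_bdd_above compact_imp_bounded compact_continuous_image continuous_intros)
  have h_norm: "?h u \<le> set_norm K * norm u" for u
    unfolding support_fun_def
  proof (rule cSUP_least[OF K(1)])
    fix x assume "x \<in> K"
    have "x \<bullet> u \<le> norm x * norm u" by (rule norm_cauchy_schwarz)
    also have "\<dots> \<le> set_norm K * norm u"
      unfolding set_norm_def by (intro mult_right_mono cSUP_upper[OF \<open>x \<in> K\<close> bddn]) simp
    finally show "x \<bullet> u \<le> set_norm K * norm u" .
  qed
  let ?D = "real CARD('n) powr (\<alpha> / 2) - 1"
  have D: "0 \<le> ?D" using assms by (simp add: ge_one_powr_ge_zero Suc_le_eq)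
  have "m_dist \<alpha> M \<xi> N (\<lambda>x. x) \<le> ereal (?D * set_norm K powr \<alpha>)"
    unfolding m_dist_def
  proof (rule SUP_least)
    fix u :: "real^'n" assume "u \<in> - {0}"
    then have u: "0 < norm u" by simp
    let ?e = "norm (transpose B *v u)"
    have h0: "0 \<le> ?h u" using B1[of u] norm_ge_zero order_trans by blast
    have "?e powr \<alpha> \<le> ?h u powr \<alpha>" using B1[of u] assms by (intro powr_mono2) auto
    moreover have "?h u powr \<alpha> \<le> (sqrt CARD('n) * ?e) powr \<alpha>" using B2[of u] h0 assms by (intro powr_mono2) auto
    moreover have "(sqrt CARD('n) * ?e) powr \<alpha> = real CARD('n) powr (\<alpha> / 2) * ?e powr \<alpha>"
      by (simp add: powr_mult powr_powr flip: powr_half_sqrt)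
    ultimately have "\<bar>?h u powr \<alpha> - ?e powr \<alpha>\<bar> \<le> ?D * ?e powr \<alpha>" by (simp add: algebra_simps)
    also have "\<dots> \<le> ?D * ?h u powr \<alpha>" using \<open>?e powr \<alpha> \<le> ?h u powr \<alpha>\<close> D by (rule mult_left_mono)
    also have "\<dots> \<le> ?D * (set_norm K * norm u) powr \<alpha>"
      using h_norm[of u] h0 assms D by (intro mult_left_mono powr_mono2) auto
    finally have diff: "\<bar>?h u powr \<alpha> - ?e powr \<alpha>\<bar> \<le> ?D * set_norm K powr \<alpha> * norm u powr \<alpha>"
      by (simp add: powr_mult mult.assoc)
    have "cmod (ln (char_fun M \<xi> u) - ln (char_fun N (\<lambda>x. x) u)) = \<bar>?h u powr \<alpha> - ?e powr \<alpha>\<bar>"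
      unfolding cf\<xi> cf by (simp only: Ln_of_real exp_gt_zero ln_exp of_real_diff[symmetric] norm_of_real)
    then have "norm u powr (- \<alpha>) * cmod (ln (char_fun M \<xi> u) - ln (char_fun N (\<lambda>x. x) u))
        \<le> norm u powr (- \<alpha>) * (?D * set_norm K powr \<alpha> * norm u powr \<alpha>)"
      using diff by (intro mult_left_mono) auto
    also have "\<dots> = ?D * set_norm K powr \<alpha> * (norm u powr (- \<alpha>) * norm u powr \<alpha>)" by (simp only: ac_simps)
    also have "norm u powr (- \<alpha>) * norm u powr \<alpha> = 1" using u by (simp flip: powr_add)
    finally show "ereal (norm u powr (- \<alpha>) * cmod (ln (char_fun M \<xi> u) - ln (char_fun N (\<lambda>x. x) u)))
        \<le> ereal (?D * set_norm K powr \<alpha>)" by simp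
  qed
  with N show ?thesis by blast
qed

end
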